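(* Let $\mathcal A(M)$ be an associative, commutative, unital algebra which is a unital $C^\infty(M)$-module and for which there is a linear embedding $\iota:\mathcal D'(M)\to\mathcal A(M)$ such that $\iota(1)$ is the unit of $\mathcal A(M)$. Then the following are equivalent: (i) The map $\iota\otimes\mathrm{id}:\mathcal D'(M)\otimes_{\mathbb R}C^\infty(M)\to\mathcal A(M)\otimes_{C^\infty(M)}C^\infty(M)$ is $C^\infty(M)$-balanced, i.e. $(\iota\otimes\mathrm{id})(fv\otimes g)=(\iota\otimes\mathrm{id})(v\otimes fg)$ for all $v\in\mathcal D'(M)$ and $f,g\in C^\infty(M)$ (so that $\iota\otimes\mathrm{id}$ is well-defined on $\mathcal D'(M)\otimes_{C^\infty(M)}C^\infty(M)$). (ii) $\iota$ is $C^\infty(M)$-linear.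
   Context: $M$ is an orientable (with fixed orientation), paracompact, smooth Hausdorff manifold of finite dimension $n$. $\mathcal D'(M):=(\Omega^n_{\mathrm c}(M))'$ is the space of (scalar) distributions, i.e. the topological dual of the (LF)-space of compactly supported smooth $n$-forms; it is a $C^\infty(M)$-module via $\langle fv,\omega\rangle=\langle v,f\omega\rangle$, and $C^\infty(M)\subseteq\mathcal D'(M)$ via $\langle f,\omega\rangle=\int_Mf\omega$ (so $1\in\mathcal D'(M)$). The map $\iota\otimes\mathrm{id}$ sends $v\otimes f$ to $\iota(v)\otimes f$. *)

theory Defs
  imports
    "HOL-Analysis.Analysis"
    "HOL-Algebra.Free_Abelian_Groups"
    "Jordan_Normal_Form.VS_Connect"
    "Jordan_Normal_Form.Determinant"
begin

section \<open>Smooth functions on open subsets of Euclidean space\<close>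

text \<open>
  Coordinates are indexed by natural numbers below \<open>n\<close> and points live in
  \<^const>\<open>Euclidean_space\<close>, so that the dimension is an arbitrary natural number, \<open>0\<close> included.
\<close>

definition partial_deriv :: "nat \<Rightarrow> ((nat \<Rightarrow> real) \<Rightarrow> real) \<Rightarrow> (nat \<Rightarrow> real) \<Rightarrow> real" where
  "partial_deriv i f x = deriv (\<lambda>t. f (x(i := t))) (x i)"

primrec iter_partial :: "nat list \<Rightarrow> ((nat \<Rightarrow> real) \<Rightarrow> real) \<Rightarrow> (nat \<Rightarrow> real) \<Rightarrow> real" where
  "iter_partial [] f = f"
| "iter_partial (i # is) f = partial_deriv i (iter_partial is f)"

text \<open>Only meant for \<open>W\<close> open in \<^term>\<open>Euclidean_space n\<close>.\<close>

definition smooth_on_Euclidean ::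
    "nat \<Rightarrow> (nat \<Rightarrow> real) set \<Rightarrow> ((nat \<Rightarrow> real) \<Rightarrow> real) \<Rightarrow> bool" where
  "smooth_on_Euclidean n W f \<longleftrightarrow>
     (\<forall>is. set is \<subseteq> {..<n} \<longrightarrow>
        continuous_map (subtopology (Euclidean_space n) W) euclideanreal (iter_partial is f) \<and>
        (\<forall>i<n. \<forall>x\<in>W. (\<lambda>t. iter_partial is f (x(i := t))) field_differentiable at (x i)))"

section \<open>Oriented smooth manifolds\<close>

definition paracompact_space :: "'a topology \<Rightarrow> bool" where
  "paracompact_space X \<longleftrightarrow>
     (\<forall>\<U>. (\<forall>U\<in>\<U>. openin X U) \<and> \<Union>\<U> = topspace X \<longrightarrow>
       (\<exists>\<V>. (\<forall>V\<in>\<V>. openin X V) \<and> \<Union>\<V> = topspace X \<and> (\<forall>V\<in>\<V>. \<exists>U\<in>\<U>. V \<subseteq> U) \<and>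
            locally_finite_in X \<V>))"

type_synonym 'a chart = "'a set \<times> ('a \<Rightarrow> nat \<Rightarrow> real)"

text \<open>
  The orientation is given as a section of the orientation covering: for every chart \<open>c\<close> and
  every point \<open>p\<close> of its domain, \<open>osign M c p\<close> is \<open>1\<close> or \<open>-1\<close> according to whether \<open>c\<close> is
  positively or negatively oriented at \<open>p\<close>. In dimension \<open>0\<close> this is a choice of a sign for every
  point, which an atlas with positive Jacobian determinants could not express.
\<close>

record 'a oriented_manifold =
  mtop :: "'a topology"
  mdim :: nat
  atlas :: "'a chart set"
  osign :: "'a chart \<Rightarrow> 'a \<Rightarrow> real"

abbreviation chart_inv :: "'a chart \<Rightarrow> (nat \<Rightarrow> real) \<Rightarrow> 'a" where
  "chart_inv c \<equiv> inv_into (fst c) (snd c)"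

abbreviation chart_image :: "'a chart \<Rightarrow> (nat \<Rightarrow> real) set" where
  "chart_image c \<equiv> snd c ` fst c"

definition is_chart :: "'a topology \<Rightarrow> nat \<Rightarrow> 'a chart \<Rightarrow> bool" where
  "is_chart X n c \<longleftrightarrow>
     openin X (fst c) \<and> openin (Euclidean_space n) (chart_image c) \<and>
     homeomorphic_map (subtopology X (fst c))
       (subtopology (Euclidean_space n) (chart_image c)) (snd c)"

definition smooth_transition :: "nat \<Rightarrow> 'a chart \<Rightarrow> 'a chart \<Rightarrow> bool" where
  "smooth_transition n c d \<longleftrightarrow>
     (\<forall>i<n. smooth_on_Euclidean n (snd c ` (fst c \<inter> fst d)) (\<lambda>x. snd d (chart_inv c x) i))"

definition jacobian_det :: "nat \<Rightarrow> 'a chart \<Rightarrow> 'a chart \<Rightarrow> (nat \<Rightarrow> real) \<Rightarrow> real" where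
  "jacobian_det n c d x =
     Determinant.det (Matrix.mat n n (\<lambda>(i, j). partial_deriv j (\<lambda>y. snd d (chart_inv c y) i) x))"

definition smooth_atlas :: "'a topology \<Rightarrow> nat \<Rightarrow> 'a chart set \<Rightarrow> bool" where
  "smooth_atlas X n \<A> \<longleftrightarrow>
     (\<forall>c\<in>\<A>. is_chart X n c) \<and> (\<Union>c\<in>\<A>. fst c) = topspace X \<and>
     (\<forall>c\<in>\<A>. \<forall>d\<in>\<A>. smooth_transition n c d)"

definition is_orientation ::
    "'a topology \<Rightarrow> nat \<Rightarrow> 'a chart set \<Rightarrow> ('a chart \<Rightarrow> 'a \<Rightarrow> real) \<Rightarrow> bool" where
  "is_orientation X n \<A> s \<longleftrightarrow>
     (\<forall>c\<in>\<A>. s c ` fst c \<subseteq> {1, - 1} \<and>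
             continuous_map (subtopology X (fst c)) euclideanreal (s c)) \<and>
     (\<forall>c\<in>\<A>. \<forall>d\<in>\<A>. \<forall>p \<in> fst c \<inter> fst d.
        s d p = sgn (jacobian_det n c d (snd c p)) * s c p)"

definition oriented_smooth_manifold :: "'a oriented_manifold \<Rightarrow> bool" where
  "oriented_smooth_manifold M \<longleftrightarrow>
     Hausdorff_space (mtop M) \<and> paracompact_space (mtop M) \<and>
     smooth_atlas (mtop M) (mdim M) (atlas M) \<and>
     is_orientation (mtop M) (mdim M) (atlas M) (osign M)"

section \<open>Smooth functions\<close>

text \<open>
  Elements of function spaces on a carrier are represented by total functions that vanish off
  that carrier; thus all vector space operations are pointwise. The following structure is at
  the same time the real vector space and the ring of smooth functions.
\<close>

definition Cinf :: "'a oriented_manifold \<Rightarrow> (real, 'a \<Rightarrow> real) module" where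
  "Cinf M = \<lparr>
     carrier = {f. (\<forall>p. p \<notin> topspace (mtop M) \<longrightarrow> f p = 0) \<and>
                   (\<forall>c\<in>atlas M. smooth_on_Euclidean (mdim M) (chart_image c) (\<lambda>x. f (chart_inv c x)))},
     mult = (\<lambda>f g p. f p * g p),
     one = indicat_real (topspace (mtop M)),
     zero = (\<lambda>p. 0),
     add = (\<lambda>f g p. f p + g p),
     smult = (\<lambda>r f p. r * f p)\<rparr>"

section \<open>Tangent vectors and differential forms of top degree\<close>

type_synonym 'a tangent = "('a \<Rightarrow> real) \<Rightarrow> real"
type_synonym 'a form = "'a \<Rightarrow> (nat \<Rightarrow> 'a tangent) \<Rightarrow> real"

definition tangent_space :: "'a oriented_manifold \<Rightarrow> 'a \<Rightarrow> 'a tangent set" where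
  "tangent_space M p =
     {D. (\<forall>f. f \<notin> carrier (Cinf M) \<longrightarrow> D f = 0) \<and>
         (\<forall>f\<in>carrier (Cinf M). \<forall>g\<in>carrier (Cinf M).
            D (f \<oplus>\<^bsub>Cinf M\<^esub> g) = D f + D g \<and>
            D (f \<otimes>\<^bsub>Cinf M\<^esub> g) = f p * D g + g p * D f) \<and>
         (\<forall>r. \<forall>f\<in>carrier (Cinf M). D (r \<odot>\<^bsub>Cinf M\<^esub> f) = r * D f)}"

definition coord_vector :: "'a oriented_manifold \<Rightarrow> 'a chart \<Rightarrow> 'a \<Rightarrow> nat \<Rightarrow> 'a tangent" where
  "coord_vector M c p i f =
     (if f \<in> carrier (Cinf M) then partial_deriv i (\<lambda>x. f (chart_inv c x)) (snd c p) else 0)"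

definition alternating_multilinear :: "nat \<Rightarrow> 'a tangent set \<Rightarrow> ((nat \<Rightarrow> 'a tangent) \<Rightarrow> real) \<Rightarrow> bool"
  where
  "alternating_multilinear n T w \<longleftrightarrow>
     (\<forall>X. X \<notin> {..<n} \<rightarrow>\<^sub>E T \<longrightarrow> w X = 0) \<and>
     (\<forall>X \<in> {..<n} \<rightarrow>\<^sub>E T. \<forall>i<n. \<forall>Y\<in>T. \<forall>Z\<in>T.
        w (X(i := (\<lambda>f. Y f + Z f))) = w (X(i := Y)) + w (X(i := Z))) \<and>
     (\<forall>X \<in> {..<n} \<rightarrow>\<^sub>E T. \<forall>i<n. \<forall>Y\<in>T. \<forall>r.
        w (X(i := (\<lambda>f. r * Y f))) = r * w (X(i := Y))) \<and>
     (\<forall>X \<in> {..<n} \<rightarrow>\<^sub>E T. \<forall>i<n. \<forall>j<n. i \<noteq> j \<and> X i = X j \<longrightarrow> w X = 0)"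

text \<open>The coefficient of a form with respect to \<open>dx\<^sub>0 \<and> \<dots> \<and> dx\<^bsub>n-1\<^esub>\<close> in a chart.\<close>

definition form_coeff ::
    "'a oriented_manifold \<Rightarrow> 'a chart \<Rightarrow> 'a form \<Rightarrow> (nat \<Rightarrow> real) \<Rightarrow> real" where
  "form_coeff M c \<omega> x =
     \<omega> (chart_inv c x) (restrict (coord_vector M c (chart_inv c x)) {..<mdim M})"

definition top_forms :: "'a oriented_manifold \<Rightarrow> 'a form set" where
  "top_forms M =
     {\<omega>. (\<forall>p. p \<notin> topspace (mtop M) \<longrightarrow> \<omega> p = (\<lambda>X. 0)) \<and>
         (\<forall>p\<in>topspace (mtop M). alternating_multilinear (mdim M) (tangent_space M p) (\<omega> p)) \<and>
         (\<forall>c\<in>atlas M. smooth_on_Euclidean (mdim M) (chart_image c) (form_coeff M c \<omega>))}"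

definition form_support :: "'a oriented_manifold \<Rightarrow> 'a form \<Rightarrow> 'a set" where
  "form_support M \<omega> = mtop M closure_of {p \<in> topspace (mtop M). \<omega> p \<noteq> (\<lambda>X. 0)}"

definition compact_forms :: "'a oriented_manifold \<Rightarrow> 'a form set" where
  "compact_forms M = {\<omega> \<in> top_forms M. compactin (mtop M) (form_support M \<omega>)}"

definition form_add :: "'a form \<Rightarrow> 'a form \<Rightarrow> 'a form" where
  "form_add \<omega> \<eta> = (\<lambda>p X. \<omega> p X + \<eta> p X)"

definition form_scale :: "real \<Rightarrow> 'a form \<Rightarrow> 'a form" where
  "form_scale r \<omega> = (\<lambda>p X. r * \<omega> p X)"

definition form_mult :: "('a \<Rightarrow> real) \<Rightarrow> 'a form \<Rightarrow> 'a form" where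
  "form_mult f \<omega> = (\<lambda>p X. f p * \<omega> p X)"

section \<open>Integration of compactly supported top degree forms\<close>

text \<open>
  The integral of a form with compact support in the domain of the chart \<open>c\<close>. The elements of
  the product measure space are functions on \<open>{..<n}\<close>, which have to be extended by \<open>0\<close>
  to become points of \<^term>\<open>Euclidean_space n\<close>.
\<close>

definition chart_integral :: "'a oriented_manifold \<Rightarrow> 'a chart \<Rightarrow> 'a form \<Rightarrow> real" where
  "chart_integral M c \<omega> =
     (LINT y | Pi\<^sub>M {..<mdim M} (\<lambda>i. lborel).
        (let x = (\<lambda>i. if i < mdim M then y i else 0) in
         if x \<in> chart_image c then osign M c (chart_inv c x) * form_coeff M c \<omega> x else 0))"

text \<open>
  The integral is computed with some finite family of smooth functions subordinate to the atlas
  that is a partition of unity on the support of the form; the value does not depend on it.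
\<close>

definition form_integral :: "'a oriented_manifold \<Rightarrow> 'a form \<Rightarrow> real" where
  "form_integral M \<omega> =
     (SOME s. \<exists>(m::nat) (c :: nat \<Rightarrow> 'a chart) \<rho>.
        (\<forall>k<m. c k \<in> atlas M \<and> \<rho> k \<in> carrier (Cinf M) \<and> (\<forall>p. 0 \<le> \<rho> k p) \<and>
               mtop M closure_of {p \<in> topspace (mtop M). \<rho> k p \<noteq> 0} \<subseteq> fst (c k)) \<and>
        (\<forall>p\<in>form_support M \<omega>. (\<Sum>k<m. \<rho> k p) = 1) \<and>
        s = (\<Sum>k<m. chart_integral M (c k) (form_mult (\<rho> k) \<omega>)))"

section \<open>The LF-topology and distributions\<close>

definition form_seminorm ::
    "'a oriented_manifold \<Rightarrow> 'a chart \<Rightarrow> 'a set \<Rightarrow> nat list \<Rightarrow> 'a form \<Rightarrow> real" where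
  "form_seminorm M c L is \<omega> =
     Sup (insert 0 ((\<lambda>x. \<bar>iter_partial is (form_coeff M c \<omega>) x\<bar>) ` snd c ` L))"

definition forms_supported_in :: "'a oriented_manifold \<Rightarrow> 'a set \<Rightarrow> 'a form set" where
  "forms_supported_in M K = {\<omega> \<in> top_forms M. form_support M \<omega> \<subseteq> K}"

text \<open>
  For compact \<open>K\<close>, the intersection of \<open>V\<close> with the forms supported in \<open>K\<close> is a neighbourhood
  of \<open>0\<close> in the Frechet topology of uniform convergence of all derivatives of the coefficients
  on compact subsets of chart domains.
\<close>

definition Frechet_zero_nhd :: "'a oriented_manifold \<Rightarrow> 'a set \<Rightarrow> 'a form set \<Rightarrow> bool" where
  "Frechet_zero_nhd M K V \<longleftrightarrow>
     (\<exists>S \<epsilon>. finite S \<and> 0 < \<epsilon> \<and>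
        S \<subseteq> {(c, L, is). c \<in> atlas M \<and> compactin (mtop M) L \<and> L \<subseteq> fst c \<and> set is \<subseteq> {..<mdim M}} \<and>
        {\<omega> \<in> forms_supported_in M K. \<forall>(c, L, is)\<in>S. form_seminorm M c L is \<omega> < \<epsilon>} \<subseteq> V)"

definition absolutely_convex :: "'a form set \<Rightarrow> bool" where
  "absolutely_convex V \<longleftrightarrow>
     (\<forall>\<omega>\<in>V. \<forall>\<eta>\<in>V. \<forall>a b. \<bar>a\<bar> + \<bar>b\<bar> \<le> 1 \<longrightarrow> form_add (form_scale a \<omega>) (form_scale b \<eta>) \<in> V)"

definition LF_zero_nhd :: "'a oriented_manifold \<Rightarrow> 'a form set \<Rightarrow> bool" where
  "LF_zero_nhd M V \<longleftrightarrow>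
     V \<subseteq> compact_forms M \<and> absolutely_convex V \<and>
     (\<forall>K. compactin (mtop M) K \<longrightarrow> Frechet_zero_nhd M K V)"

text \<open>
  The locally convex inductive limit of the spaces of forms supported in a compact set: the
  absolutely convex sets whose trace on each of these spaces is a neighbourhood of \<open>0\<close> form
  a base of neighbourhoods of \<open>0\<close>.
\<close>

definition LF_topology :: "'a oriented_manifold \<Rightarrow> 'a form topology" where
  "LF_topology M = topology (\<lambda>U. U \<subseteq> compact_forms M \<and>
     (\<forall>\<omega>\<in>U. \<exists>V. LF_zero_nhd M V \<and> form_add \<omega> ` V \<subseteq> U))"

lemma Frechet_zero_nhd_Int:
  assumes "Frechet_zero_nhd M K V" "Frechet_zero_nhd M K W"
  shows "Frechet_zero_nhd M K (V \<inter> W)"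
proof -
  obtain S d where S: "finite S" "0 < d"
    "S \<subseteq> {(c, L, is). c \<in> atlas M \<and> compactin (mtop M) L \<and> L \<subseteq> fst c \<and> set is \<subseteq> {..<mdim M}}"
    "{\<omega> \<in> forms_supported_in M K. \<forall>(c, L, is)\<in>S. form_seminorm M c L is \<omega> < d} \<subseteq> V"
    using assms(1) unfolding Frechet_zero_nhd_def by blast
  obtain T e where T: "finite T" "0 < e"
    "T \<subseteq> {(c, L, is). c \<in> atlas M \<and> compactin (mtop M) L \<and> L \<subseteq> fst c \<and> set is \<subseteq> {..<mdim M}}"
    "{\<omega> \<in> forms_supported_in M K. \<forall>(c, L, is)\<in>T. form_seminorm M c L is \<omega> < e} \<subseteq> W"
    using assms(2) unfolding Frechet_zero_nhd_def by blast
  have "{\<omega> \<in> forms_supported_in M K. \<forall>(c, L, is)\<in>S \<union> T. form_seminorm M c L is \<omega> < min d e}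
      \<subseteq> V \<inter> W"
    using S(4) T(4) by fastforce
  moreover have "S \<union> T \<subseteq> {(c, L, is). c \<in> atlas M \<and> compactin (mtop M) L \<and> L \<subseteq> fst c \<and>
      set is \<subseteq> {..<mdim M}}"
    using S(3) T(3) by (rule Un_least)
  ultimately show ?thesis
    unfolding Frechet_zero_nhd_def using S(1,2) T(1,2)
    by (intro exI[of _ "S \<union> T"] exI[of _ "min d e"]) auto
qed

lemma LF_zero_nhd_Int: "LF_zero_nhd M V \<Longrightarrow> LF_zero_nhd M W \<Longrightarrow> LF_zero_nhd M (V \<inter> W)"
  unfolding LF_zero_nhd_def absolutely_convex_def by (auto intro: Frechet_zero_nhd_Int)

lemma openin_LF_topology:
  "openin (LF_topology M) U \<longleftrightarrow>
     U \<subseteq> compact_forms M \<and> (\<forall>\<omega>\<in>U. \<exists>V. LF_zero_nhd M V \<and> form_add \<omega> ` V \<subseteq> U)"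
proof -
  have "istopology (\<lambda>U. U \<subseteq> compact_forms M \<and>
     (\<forall>\<omega>\<in>U. \<exists>V. LF_zero_nhd M V \<and> form_add \<omega> ` V \<subseteq> U))"
    unfolding istopology_def
  proof (intro conjI allI impI ballI)
    fix S T \<omega>
    assume S: "S \<subseteq> compact_forms M \<and> (\<forall>\<omega>\<in>S. \<exists>V. LF_zero_nhd M V \<and> form_add \<omega> ` V \<subseteq> S)"
      and T: "T \<subseteq> compact_forms M \<and> (\<forall>\<omega>\<in>T. \<exists>V. LF_zero_nhd M V \<and> form_add \<omega> ` V \<subseteq> T)"
      and \<omega>: "\<omega> \<in> S \<inter> T"
    obtain V where V: "LF_zero_nhd M V" "form_add \<omega> ` V \<subseteq> S" using S \<omega> by blast
    obtain W where W: "LF_zero_nhd M W" "form_add \<omega> ` W \<subseteq> T" using T \<omega> by blast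
    show "\<exists>V. LF_zero_nhd M V \<and> form_add \<omega> ` V \<subseteq> S \<inter> T"
      using LF_zero_nhd_Int[OF V(1) W(1)] V(2) W(2) by (intro exI[of _ "V \<inter> W"]) blast
  next
    fix \<K> \<omega>
    assume K: "\<forall>U\<in>\<K>. U \<subseteq> compact_forms M \<and> (\<forall>\<omega>\<in>U. \<exists>V. LF_zero_nhd M V \<and> form_add \<omega> ` V \<subseteq> U)"
      and "\<omega> \<in> \<Union>\<K>"
    then obtain U where U: "U \<in> \<K>" "\<omega> \<in> U" by blast
    then obtain V where "LF_zero_nhd M V" "form_add \<omega> ` V \<subseteq> U" using K by metis
    then show "\<exists>V. LF_zero_nhd M V \<and> form_add \<omega> ` V \<subseteq> \<Union>\<K>" using U(1) by blast
  qed (simp_all add: le_infI1 Union_least)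
  then show ?thesis
    unfolding LF_topology_def by (simp add: topology_inverse')
qed

text \<open>
  The space of distributions as a real vector space; the ring part of the record is not used.
\<close>

definition distributions :: "'a oriented_manifold \<Rightarrow> (real, 'a form \<Rightarrow> real) module" where
  "distributions M = \<lparr>
     carrier = {v. (\<forall>\<omega>. \<omega> \<notin> compact_forms M \<longrightarrow> v \<omega> = 0) \<and>
                   (\<forall>\<omega>\<in>compact_forms M. \<forall>\<eta>\<in>compact_forms M. v (form_add \<omega> \<eta>) = v \<omega> + v \<eta>) \<and>
                   (\<forall>r. \<forall>\<omega>\<in>compact_forms M. v (form_scale r \<omega>) = r * v \<omega>) \<and>
                   continuous_map (LF_topology M) euclideanreal v},
     mult = undefined,
     one = undefined,
     zero = (\<lambda>\<omega>. 0),
     add = (\<lambda>v w \<omega>. v \<omega> + w \<omega>),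
     smult = (\<lambda>r v \<omega>. r * v \<omega>)\<rparr>"

definition distr_mult ::
    "'a oriented_manifold \<Rightarrow> ('a \<Rightarrow> real) \<Rightarrow> ('a form \<Rightarrow> real) \<Rightarrow> 'a form \<Rightarrow> real" where
  "distr_mult M f v = (\<lambda>\<omega>. if \<omega> \<in> compact_forms M then v (form_mult f \<omega>) else 0)"

definition function_distr :: "'a oriented_manifold \<Rightarrow> ('a \<Rightarrow> real) \<Rightarrow> 'a form \<Rightarrow> real" where
  "function_distr M f = (\<lambda>\<omega>. if \<omega> \<in> compact_forms M then form_integral M (form_mult f \<omega>) else 0)"

section \<open>Modules over several rings and tensor products\<close>

definition with_smult :: "('r, 'm) module \<Rightarrow> ('s \<Rightarrow> 'm \<Rightarrow> 'm) \<Rightarrow> ('s, 'm) module" where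
  "with_smult N act =
     \<lparr>carrier = carrier N, mult = mult N, one = one N, zero = zero N, add = add N, smult = act\<rparr>"

abbreviation Cinf_self_module :: "'a oriented_manifold \<Rightarrow> ('a \<Rightarrow> real, 'a \<Rightarrow> real) module" where
  "Cinf_self_module M \<equiv> with_smult (Cinf M) (mult (Cinf M))"

abbreviation distributions_Cinf ::
    "'a oriented_manifold \<Rightarrow> ('a \<Rightarrow> real, 'a form \<Rightarrow> real) module" where
  "distributions_Cinf M \<equiv> with_smult (distributions M) (distr_mult M)"

definition tensor_relators ::
    "('r, 'x) ring_scheme \<Rightarrow> ('r, 'm) module \<Rightarrow> ('r, 'n) module \<Rightarrow> ('m \<times> 'n \<Rightarrow>\<^sub>0 int) set" where
  "tensor_relators R M N =
     {frag_of (m \<oplus>\<^bsub>M\<^esub> m', n) - frag_of (m, n) - frag_of (m', n) | m m' n.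
        m \<in> carrier M \<and> m' \<in> carrier M \<and> n \<in> carrier N} \<union>
     {frag_of (m, n \<oplus>\<^bsub>N\<^esub> n') - frag_of (m, n) - frag_of (m, n') | m n n'.
        m \<in> carrier M \<and> n \<in> carrier N \<and> n' \<in> carrier N} \<union>
     {frag_of (r \<odot>\<^bsub>M\<^esub> m, n) - frag_of (m, r \<odot>\<^bsub>N\<^esub> n) | r m n.
        r \<in> carrier R \<and> m \<in> carrier M \<and> n \<in> carrier N}"

definition tensor_kernel ::
    "('r, 'x) ring_scheme \<Rightarrow> ('r, 'm) module \<Rightarrow> ('r, 'n) module \<Rightarrow> ('m \<times> 'n \<Rightarrow>\<^sub>0 int) set" where
  "tensor_kernel R M N =
     generate (free_Abelian_group (carrier M \<times> carrier N)) (tensor_relators R M N)"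

definition tensor_product ::
    "('r, 'x) ring_scheme \<Rightarrow> ('r, 'm) module \<Rightarrow> ('r, 'n) module \<Rightarrow> ('m \<times> 'n \<Rightarrow>\<^sub>0 int) set monoid"
  where
  "tensor_product R M N =
     free_Abelian_group (carrier M \<times> carrier N) Mod tensor_kernel R M N"

definition tensor ::
    "('r, 'x) ring_scheme \<Rightarrow> ('r, 'm) module \<Rightarrow> ('r, 'n) module \<Rightarrow> 'm \<Rightarrow> 'n \<Rightarrow> ('m \<times> 'n \<Rightarrow>\<^sub>0 int) set"
  where
  "tensor R M N m n =
     tensor_kernel R M N #>\<^bsub>free_Abelian_group (carrier M \<times> carrier N)\<^esub> frag_of (m, n)"

text \<open>
  The map \<open>h \<otimes> k\<close> into the tensor product of \<open>M\<close> and \<open>N\<close> over \<open>R\<close>, on cosets of formal sums of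
  pairs. The source may be a tensor product over another ring: when \<open>h \<otimes> k\<close> is well-defined, all
  the cosets in the union are equal.
\<close>

definition tensor_map ::
    "('r, 'x) ring_scheme \<Rightarrow> ('r, 'm) module \<Rightarrow> ('r, 'n) module \<Rightarrow>
     ('m0 \<Rightarrow> 'm) \<Rightarrow> ('n0 \<Rightarrow> 'n) \<Rightarrow> ('m0 \<times> 'n0 \<Rightarrow>\<^sub>0 int) set \<Rightarrow> ('m \<times> 'n \<Rightarrow>\<^sub>0 int) set" where
  "tensor_map R M N h k X =
     (\<Union>x\<in>X. tensor_kernel R M N #>\<^bsub>free_Abelian_group (carrier M \<times> carrier N)\<^esub>
        frag_extend (\<lambda>(m, n). frag_of (h m, k n)) x)"

lemma tensor_in_tensor_product:
  "m \<in> carrier M \<Longrightarrow> n \<in> carrier N \<Longrightarrow> tensor R M N m n \<in> carrier (tensor_product R M N)"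
  unfolding tensor_def tensor_product_def FactGroup_def RCOSETS_def by auto

lemma tensor_map_tensor:
  fixes h :: "'m0 \<Rightarrow> 'm" and k :: "'n0 \<Rightarrow> 'n"
  defines "\<phi> \<equiv> frag_extend (\<lambda>(m, n). frag_of (h m, k n))"
  assumes rel0: "tensor_relators R\<^sub>0 M\<^sub>0 N\<^sub>0 \<subseteq> carrier (free_Abelian_group (carrier M\<^sub>0 \<times> carrier N\<^sub>0))"
    and rel: "tensor_relators R M N \<subseteq> carrier (free_Abelian_group (carrier M \<times> carrier N))"
    and resp: "\<phi> ` tensor_relators R\<^sub>0 M\<^sub>0 N\<^sub>0 \<subseteq> tensor_kernel R M N"
    and mn: "h m \<in> carrier M" "k n \<in> carrier N"
  shows "tensor_map R M N h k (tensor R\<^sub>0 M\<^sub>0 N\<^sub>0 m n) = tensor R M N (h m) (k n)"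
proof -
  let ?F = "free_Abelian_group (carrier M \<times> carrier N)"
  let ?F\<^sub>0 = "free_Abelian_group (carrier M\<^sub>0 \<times> carrier N\<^sub>0)"
  let ?K = "tensor_kernel R M N" and ?K\<^sub>0 = "tensor_kernel R\<^sub>0 M\<^sub>0 N\<^sub>0"
  interpret F: group ?F by simp
  have K: "subgroup ?K ?F"
    unfolding tensor_kernel_def by (rule F.generate_is_subgroup[OF rel])
  have \<phi>K: "\<phi> z \<in> ?K" if "z \<in> ?K\<^sub>0" for z
    using that[unfolded tensor_kernel_def]
  proof (induction rule: generate.induct)
    case one
    then show ?case using subgroup.one_closed[OF K] by (simp add: \<phi>_def)
  next
    case (incl z)
    then show ?case using resp by blast
  next
    case (inv z)
    have "\<phi> z \<in> ?K" using resp inv by blast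
    then have "- \<phi> z \<in> ?K"
      using subgroup.m_inv_closed[OF K] subgroup.mem_carrier[OF K] inv_free_Abelian_group
      by (metis carrier_free_Abelian_group_iff)
    moreover have "inv\<^bsub>?F\<^sub>0\<^esub> z = - z" using rel0 inv by auto
    ultimately show ?case by (simp add: \<phi>_def frag_extend_minus)
  next
    case (eng y z)
    then show ?case using subgroup.m_closed[OF K] by (simp add: \<phi>_def frag_extend_add)
  qed
  have coset: "?K #>\<^bsub>?F\<^esub> \<phi> (z + frag_of (m, n)) = tensor R M N (h m) (k n)" if "z \<in> ?K\<^sub>0" for z
  proof -
    have "\<phi> (z + frag_of (m, n)) = \<phi> z \<otimes>\<^bsub>?F\<^esub> frag_of (h m, k n)"
      by (simp add: \<phi>_def frag_extend_add)
    moreover have "frag_of (h m, k n) \<in> carrier ?F" using mn by simp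
    ultimately show ?thesis
      using F.coset_join2[OF subgroup.mem_carrier[OF K] K] \<phi>K[OF that]
        F.coset_mult_assoc[OF subgroup.subset[OF K] subgroup.mem_carrier[OF K, of "\<phi> z"]]
      unfolding tensor_def by metis
  qed
  have "0 \<in> ?K\<^sub>0" using generate.one[of ?F\<^sub>0] by (simp add: tensor_kernel_def)
  moreover have "tensor R\<^sub>0 M\<^sub>0 N\<^sub>0 m n = (\<lambda>z. z + frag_of (m, n)) ` ?K\<^sub>0"
    by (auto simp: tensor_def r_coset_def)
  ultimately show ?thesis
    using coset unfolding tensor_map_def \<phi>_def[symmetric] by auto
qed

end

theory Submission
  imports Defs
begin

text \<open>
  Multiplication \<open>a \<otimes> f \<mapsto> f a\<close> is well-defined on \<open>\<A>(M) \<otimes>\<^bsub>C\<^sup>\<infinity>(M)\<^esub> C\<^sup>\<infinity>(M)\<close>. Applied to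
  \<open>\<iota>(f v) \<otimes> 1 = \<iota>(v) \<otimes> f\<close>, it yields \<open>\<iota>(f v) = f \<iota>(v)\<close>. The converse moves \<open>f\<close> across the
  tensor sign.
\<close>

section \<open>Tensor products\<close>

text \<open>Only closure is assumed, not the module axioms, so that the lemma also covers
  \<open>distributions M\<close> and \<open>Cinf M\<close> as real vector spaces, for which just
  closure is shown below.\<close>

lemma tensor_relators_subset:
  assumes "\<And>m m'. m \<in> carrier M \<Longrightarrow> m' \<in> carrier M \<Longrightarrow> m \<oplus>\<^bsub>M\<^esub> m' \<in> carrier M"
    and "\<And>n n'. n \<in> carrier N \<Longrightarrow> n' \<in> carrier N \<Longrightarrow> n \<oplus>\<^bsub>N\<^esub> n' \<in> carrier N"
    and "\<And>r m. r \<in> carrier R \<Longrightarrow> m \<in> carrier M \<Longrightarrow> r \<odot>\<^bsub>M\<^esub> m \<in> carrier M"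
    and "\<And>r n. r \<in> carrier R \<Longrightarrow> n \<in> carrier N \<Longrightarrow> r \<odot>\<^bsub>N\<^esub> n \<in> carrier N"
  shows "tensor_relators R M N \<subseteq> carrier (free_Abelian_group (carrier M \<times> carrier N))"
proof -
  have diff: "x - y \<in> carrier (free_Abelian_group S)"
    if "x \<in> carrier (free_Abelian_group S)" "y \<in> carrier (free_Abelian_group S)"
    for x y :: "'e \<times> 'f \<Rightarrow>\<^sub>0 int" and S
    using that keys_diff[of x y] by auto
  show ?thesis
    unfolding tensor_relators_def using assms
    by (auto simp del: carrier_free_Abelian_group_iff intro!: diff)
qed

lemma subgroup_tensor_kernel:
  "tensor_relators R M N \<subseteq> carrier (free_Abelian_group (carrier M \<times> carrier N)) \<Longrightarrow>
   subgroup (tensor_kernel R M N) (free_Abelian_group (carrier M \<times> carrier N))"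
  unfolding tensor_kernel_def by (rule group.generate_is_subgroup) simp_all

lemma tensor_kernel_closed:
  assumes "tensor_relators R M N \<subseteq> carrier (free_Abelian_group (carrier M \<times> carrier N))"
  shows "0 \<in> tensor_kernel R M N"
    and "x \<in> tensor_kernel R M N \<Longrightarrow> y \<in> tensor_kernel R M N \<Longrightarrow> x + y \<in> tensor_kernel R M N"
    and "x \<in> tensor_kernel R M N \<Longrightarrow> - x \<in> tensor_kernel R M N"
proof -
  let ?F = "free_Abelian_group (carrier M \<times> carrier N)"
  note K = subgroup_tensor_kernel[OF assms]
  show "0 \<in> tensor_kernel R M N"
    using subgroup.one_closed[OF K] by simp
  show "x + y \<in> tensor_kernel R M N" if "x \<in> tensor_kernel R M N" "y \<in> tensor_kernel R M N"
    using subgroup.m_closed[OF K that] by simp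
  assume "x \<in> tensor_kernel R M N"
  then show "- x \<in> tensor_kernel R M N"
    using subgroup.m_inv_closed[OF K] subgroup.mem_carrier[OF K] inv_free_Abelian_group
    by (metis carrier_free_Abelian_group_iff)
qed

text \<open>Translating by \<open>x - y\<close> inside the kernel turns one coset into the other.
  The group operation is addition of arbitrary formal sums, so \<open>x\<close> and \<open>y\<close>
  may lie outside the free group on the carriers.\<close>

lemma tensor_kernel_coset_eqI:
  assumes "tensor_relators R M N \<subseteq> carrier (free_Abelian_group (carrier M \<times> carrier N))"
    and "x - y \<in> tensor_kernel R M N"
  shows "tensor_kernel R M N #>\<^bsub>free_Abelian_group (carrier M \<times> carrier N)\<^esub> x =
    tensor_kernel R M N #>\<^bsub>free_Abelian_group (carrier M \<times> carrier N)\<^esub> y"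
proof -
  note K = tensor_kernel_closed[OF assms(1)]
  have "\<exists>k'\<in>tensor_kernel R M N. k + x = k' + y" if "k \<in> tensor_kernel R M N" for k
    using K(2)[OF that assms(2)] by (intro bexI[of _ "k + (x - y)"]) simp_all
  moreover have "\<exists>k'\<in>tensor_kernel R M N. k + y = k' + x" if "k \<in> tensor_kernel R M N" for k
    using K(2)[OF that K(3)[OF assms(2)]] by (intro bexI[of _ "k + - (x - y)"]) simp_all
  ultimately show ?thesis
    by (auto simp: r_coset_def)
qed

lemma tensor_smult:
  assumes "tensor_relators R M N \<subseteq> carrier (free_Abelian_group (carrier M \<times> carrier N))"
    and "r \<in> carrier R" "m \<in> carrier M" "n \<in> carrier N"
  shows "tensor R M N (r \<odot>\<^bsub>M\<^esub> m) n = tensor R M N m (r \<odot>\<^bsub>N\<^esub> n)"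
proof -
  have "frag_of (r \<odot>\<^bsub>M\<^esub> m, n) - frag_of (m, r \<odot>\<^bsub>N\<^esub> n) \<in> tensor_relators R M N"
    unfolding tensor_relators_def using assms(2-4) by blast
  then show ?thesis
    unfolding tensor_def
    by (intro tensor_kernel_coset_eqI[OF assms(1)]) (simp add: tensor_kernel_def generate.incl)
qed

text \<open>
  Unlike in \<open>tensor_map_tensor\<close>, \<open>h m\<close> and \<open>k n\<close> may lie outside the carriers. This way, the
  balancedness condition itself shows that \<open>\<iota> (f v)\<close> is in \<open>\<A>(M)\<close>, and one need not know that
  \<open>f v\<close> is continuous.
\<close>

lemma tensor_map_tensor_any:
  fixes h :: "'m0 \<Rightarrow> 'm" and k :: "'n0 \<Rightarrow> 'n"
  defines "\<phi> \<equiv> frag_extend (\<lambda>(m, n). frag_of (h m, k n))"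
  assumes rel0: "tensor_relators R\<^sub>0 M\<^sub>0 N\<^sub>0 \<subseteq> carrier (free_Abelian_group (carrier M\<^sub>0 \<times> carrier N\<^sub>0))"
    and rel: "tensor_relators R M N \<subseteq> carrier (free_Abelian_group (carrier M \<times> carrier N))"
    and resp: "\<phi> ` tensor_relators R\<^sub>0 M\<^sub>0 N\<^sub>0 \<subseteq> tensor_kernel R M N"
  shows "tensor_map R M N h k (tensor R\<^sub>0 M\<^sub>0 N\<^sub>0 m n) = tensor R M N (h m) (k n)"
proof -
  let ?F = "free_Abelian_group (carrier M \<times> carrier N)"
  let ?F\<^sub>0 = "free_Abelian_group (carrier M\<^sub>0 \<times> carrier N\<^sub>0)"
  let ?K = "tensor_kernel R M N" and ?K\<^sub>0 = "tensor_kernel R\<^sub>0 M\<^sub>0 N\<^sub>0"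
  note K = tensor_kernel_closed[OF rel]
  have \<phi>K: "\<phi> z \<in> ?K" if "z \<in> ?K\<^sub>0" for z
    using that[unfolded tensor_kernel_def]
  proof (induction rule: generate.induct)
    case (inv z)
    then have "inv\<^bsub>?F\<^sub>0\<^esub> z = - z" using rel0 by auto
    moreover have "\<phi> z \<in> ?K" using resp inv by blast
    ultimately show ?case using K(3) by (simp add: \<phi>_def frag_extend_minus)
  qed (use resp K in \<open>auto simp: \<phi>_def frag_extend_add\<close>)
  \<comment> \<open>All cosets in the union that defines \<open>tensor_map\<close> therefore
    coincide, and the union is not empty because \<open>0\<close> is in the source kernel.\<close>
  have "?K #>\<^bsub>?F\<^esub> \<phi> (z + frag_of (m, n)) = tensor R M N (h m) (k n)" if "z \<in> ?K\<^sub>0" for z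
    unfolding tensor_def using \<phi>K[OF that]
    by (intro tensor_kernel_coset_eqI[OF rel]) (simp add: \<phi>_def frag_extend_add)
  moreover have "tensor R\<^sub>0 M\<^sub>0 N\<^sub>0 m n = (\<lambda>z. z + frag_of (m, n)) ` ?K\<^sub>0"
    by (auto simp: tensor_def r_coset_def)
  ultimately show ?thesis
    using tensor_kernel_closed(1)[OF rel0] unfolding tensor_map_def \<phi>_def[symmetric] by auto
qed

text \<open>The generator \<open>frag_of (m, n)\<close> lies in its own coset even if
  \<open>m\<close> and \<open>n\<close> are arbitrary. The other coset consists of formal sums over
  the carriers, so the one pair in the support of this generator has its components there.\<close>

lemma tensor_eq_imp_carrier:
  assumes rel: "tensor_relators R M N \<subseteq> carrier (free_Abelian_group (carrier M \<times> carrier N))"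
    and eq: "tensor R M N m n = tensor R M N m' n'" and "m' \<in> carrier M" "n' \<in> carrier N"
  shows "m \<in> carrier M"
proof -
  let ?F = "free_Abelian_group (carrier M \<times> carrier N)"
  have "frag_of (m, n) \<in> tensor R M N m n"
    using tensor_kernel_closed(1)[OF rel] by (force simp: tensor_def r_coset_def)
  also note eq
  also have "tensor R M N m' n' \<subseteq> carrier ?F"
    unfolding tensor_def
    by (intro monoid.r_coset_subset_G group.is_monoid subgroup.subset[OF subgroup_tensor_kernel[OF rel]])
      (use assms(3,4) in simp_all)
  finally show ?thesis by simp
qed

text \<open>The assignment of \<open>f a\<close> to \<open>(a, f)\<close> extends to the free
  Abelian group and kills every relator, hence the whole tensor kernel. It thus takes a single value
  on each coset.\<close>

lemma tensor_self_module_eq_imp_smult_eq: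
  fixes R :: "('s, 'r) module" and N :: "('r, 'm) module"
  assumes N: "Module.module R N"
    and ab: "a \<in> carrier N" "b \<in> carrier N" and fg: "f \<in> carrier R" "g \<in> carrier R"
    and eq: "tensor R N (with_smult R (mult R)) a f = tensor R N (with_smult R (mult R)) b g"
  shows "f \<odot>\<^bsub>N\<^esub> a = g \<odot>\<^bsub>N\<^esub> b"
proof -
  let ?S = "with_smult R (mult R)"
  let ?F = "free_Abelian_group (carrier N \<times> carrier R)"
  let ?K = "tensor_kernel R N ?S"
  interpret N: Module.module R N by fact
  have S: "carrier ?S = carrier R" "add ?S = add R" "smult ?S = mult R"
    by (simp_all add: with_smult_def)
  have rel: "tensor_relators R N ?S \<subseteq> carrier (free_Abelian_group (carrier N \<times> carrier ?S))"
    by (rule tensor_relators_subset) (auto simp: S)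
  \<comment> \<open>Universal property of the free Abelian group, applied to scalar multiplication
    with the factors swapped.\<close>
  obtain h where h: "h \<in> hom ?F (add_monoid N)"
    and h_frag: "\<And>x. x \<in> carrier N \<times> carrier R \<Longrightarrow> h (frag_of x) = snd x \<odot>\<^bsub>N\<^esub> fst x"
    using N.M.a_comm_group
    by (rule comm_group.free_Abelian_group_universal[where S = "carrier N \<times> carrier R"
          and f = "\<lambda>x. snd x \<odot>\<^bsub>N\<^esub> fst x"]) auto
  interpret h: group_hom ?F "add_monoid N" h
    using h N.M.a_comm_group
    by (simp add: group_hom_def group_hom_axioms_def comm_group.axioms(2))
  have h_diff: "h (x - y) = h x \<ominus>\<^bsub>N\<^esub> h y" if "x \<in> carrier ?F" "y \<in> carrier ?F" for x y
  proof -
    have y: "- y = inv\<^bsub>?F\<^esub> y" using that(2) by simp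
    have "h (- y) = \<ominus>\<^bsub>N\<^esub> h y"
      unfolding y a_inv_def by (rule h.hom_inv[OF that(2)])
    then show ?thesis
      using h.hom_mult[of x "- y"] that by (simp add: a_minus_def keys_minus)
  qed
  have diff: "x - y \<in> carrier ?F" if "x \<in> carrier ?F" "y \<in> carrier ?F" for x y
    using that keys_diff[of x y] by auto
  \<comment> \<open>After distributivity, \<open>h\<close> sends each additivity relator to a sum
    minus its two summands.\<close>
  have cancel: "(x \<oplus>\<^bsub>N\<^esub> y) \<ominus>\<^bsub>N\<^esub> x \<ominus>\<^bsub>N\<^esub> y = \<zero>\<^bsub>N\<^esub>"
    if "x \<in> carrier N" "y \<in> carrier N" for x y
    using that N.M.r_neg[of "x \<oplus>\<^bsub>N\<^esub> y"]
    by (simp add: N.M.minus_eq N.M.minus_add N.M.a_assoc)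
  have rel_kernel: "tensor_relators R N ?S \<subseteq> kernel ?F (add_monoid N) h"
  proof
    fix z assume z: "z \<in> tensor_relators R N ?S"
    have "h z = \<zero>\<^bsub>N\<^esub>"
      using z unfolding tensor_relators_def S
    proof (elim UnE CollectE exE conjE)
      fix m m' n
      assume "z = frag_of (m \<oplus>\<^bsub>N\<^esub> m', n) - frag_of (m, n) - frag_of (m', n)"
        and "m \<in> carrier N" "m' \<in> carrier N" "n \<in> carrier R"
      then show ?thesis
        by (simp add: h_diff diff h_frag N.smult_r_distr cancel
            del: carrier_free_Abelian_group_iff)
    next
      fix m n n'
      assume "z = frag_of (m, n \<oplus>\<^bsub>R\<^esub> n') - frag_of (m, n) - frag_of (m, n')"
        and "m \<in> carrier N" "n \<in> carrier R" "n' \<in> carrier R"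
      then show ?thesis
        by (simp add: h_diff diff h_frag N.smult_l_distr cancel
            del: carrier_free_Abelian_group_iff)
    next
      fix r m n
      assume "z = frag_of (r \<odot>\<^bsub>N\<^esub> m, n) - frag_of (m, r \<otimes>\<^bsub>R\<^esub> n)"
        and "r \<in> carrier R" "m \<in> carrier N" "n \<in> carrier R"
      \<comment> \<open>The two generators are sent to \<open>n (r m)\<close> and
        \<open>(r n) m\<close>, which agree because \<open>R\<close> is commutative.\<close>
      then show ?thesis
        by (simp add: h_diff h_frag N.smult_assoc1[symmetric] N.R.m_comm N.M.minus_eq N.M.r_neg
            del: carrier_free_Abelian_group_iff)
    qed
    then show "z \<in> kernel ?F (add_monoid N) h"
      using subsetD[OF rel z] by (simp add: kernel_def S)
  qed
  have "?K \<subseteq> kernel ?F (add_monoid N) h"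
    unfolding tensor_kernel_def S
    by (rule group.generate_subgroup_incl[OF _ rel_kernel h.subgroup_kernel]) simp
  moreover have "frag_of (a, f) \<in> tensor R N ?S a f"
    using tensor_kernel_closed(1)[OF rel] by (force simp: tensor_def r_coset_def)
  then obtain z where "z \<in> ?K" "frag_of (a, f) = z + frag_of (b, g)"
    unfolding eq by (auto simp: tensor_def r_coset_def)
  ultimately have "h (frag_of (a, f)) = h z \<oplus>\<^bsub>N\<^esub> h (frag_of (b, g))"
    and "h z = \<zero>\<^bsub>N\<^esub>"
    using h.hom_mult[of z "frag_of (b, g)"] ab fg by (auto simp: kernel_def)
  then show ?thesis using ab fg by (simp add: h_frag)
qed

section \<open>Smooth functions and distributions as real vector spaces\<close>

text \<open>The coordinate line through \<open>x\<close> is continuous into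
  \<open>Euclidean_space n\<close>: as \<open>i < n\<close>, the coordinates from \<open>n\<close>
  on stay \<open>0\<close>. An identity valid on \<open>W\<close> hence holds along this line near
  \<open>x\<close>, which is all that a partial derivative sees.\<close>

lemma eventually_fun_upd_in_openin_Euclidean_space:
  assumes W: "openin (Euclidean_space n) W" and "i < n" "x \<in> W"
  shows "\<forall>\<^sub>F t in nhds (x i). x(i := t) \<in> W"
proof -
  have x: "x j = 0" if "j \<ge> n" for j
    using openin_subset[OF W] \<open>x \<in> W\<close> that by (auto simp: topspace_Euclidean_space)
  have "continuous_map euclideanreal (powertop_real UNIV) (\<lambda>t. x(i := t))"
    by (auto simp: continuous_map_componentwise_UNIV)
  then have "continuous_map euclideanreal (Euclidean_space n) (\<lambda>t. x(i := t))"
    using x \<open>i < n\<close> by (auto simp: Euclidean_space_def continuous_map_in_subtopology)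
  from openin_continuous_map_preimage[OF this W] have "open {t. x(i := t) \<in> W}"
    by simp
  then show ?thesis
    using eventually_nhds_in_open[of "{t. x(i := t) \<in> W}" "x i"] \<open>x \<in> W\<close> by simp
qed

text \<open>On \<open>W\<close> every iterated partial derivative commutes with the factor
  \<open>r\<close>, so continuity and differentiability carry over from \<open>f\<close>. Off
  \<open>W\<close> the two sides may differ, which is why openness of \<open>W\<close>
  enters.\<close>

lemma smooth_on_Euclidean_cmult:
  assumes W: "openin (Euclidean_space n) W" and f: "smooth_on_Euclidean n W f"
  shows "smooth_on_Euclidean n W (\<lambda>x. r * f x)"
proof -
  have diff: "(\<lambda>t. iter_partial is f (x(i := t))) field_differentiable at (x i)"
    if "set is \<subseteq> {..<n}" "i < n" "x \<in> W" for "is" i x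
    using f that unfolding smooth_on_Euclidean_def by blast
  have eq: "iter_partial is (\<lambda>x. r * f x) x = r * iter_partial is f x"
    if "set is \<subseteq> {..<n}" "x \<in> W" for "is" x
    using that
  proof (induction "is" arbitrary: x)
    case (Cons i "is")
    \<comment> \<open>The induction hypothesis is an identity on \<open>W\<close> only; openness
      gives it for all \<open>t\<close> near \<open>x i\<close>, enough to equate the
      derivatives.\<close>
    have "\<forall>\<^sub>F t in nhds (x i).
        iter_partial is (\<lambda>x. r * f x) (x(i := t)) = r * iter_partial is f (x(i := t))"
      using eventually_fun_upd_in_openin_Euclidean_space[OF W _ Cons.prems(2), of i] Cons
      by (auto elim: eventually_mono)
    then have "deriv (\<lambda>t. iter_partial is (\<lambda>x. r * f x) (x(i := t))) (x i) =
        deriv (\<lambda>t. r * iter_partial is f (x(i := t))) (x i)"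
      by (rule deriv_cong_ev) simp
    then show ?case
      using diff[of "is" i x] Cons.prems by (simp add: partial_deriv_def deriv_cmult)
  qed simp
  have "continuous_map (subtopology (Euclidean_space n) W) euclideanreal
      (iter_partial is (\<lambda>x. r * f x))" if "set is \<subseteq> {..<n}" for "is"
  proof (rule continuous_map_eq)
    show "continuous_map (subtopology (Euclidean_space n) W) euclideanreal
        (\<lambda>x. r * iter_partial is f x)"
      using f that unfolding smooth_on_Euclidean_def
      by (intro continuous_map_real_mult_left) blast
  qed (use eq that in auto)
  moreover have "(\<lambda>t. iter_partial is (\<lambda>x. r * f x) (x(i := t))) field_differentiable at (x i)"
    if "is": "set is \<subseteq> {..<n}" and "i < n" "x \<in> W" for "is" i x
  proof -
    have "(\<lambda>t. r * iter_partial is f (x(i := t))) field_differentiable at (x i)"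
      by (intro field_differentiable_mult field_differentiable_const diff that)
    moreover have "\<forall>\<^sub>F t in nhds (x i).
        iter_partial is (\<lambda>x. r * f x) (x(i := t)) = r * iter_partial is f (x(i := t))"
      using eventually_fun_upd_in_openin_Euclidean_space[OF W that(2,3)] eq[OF "is"]
      by (auto elim: eventually_mono)
    ultimately show ?thesis
      unfolding field_differentiable_def by (subst DERIV_cong_ev[OF refl _ refl])
  qed
  ultimately show ?thesis
    unfolding smooth_on_Euclidean_def by blast
qed

lemma Cinf_smult_closed:
  assumes "oriented_smooth_manifold M" and "f \<in> carrier (Cinf M)"
  shows "r \<odot>\<^bsub>Cinf M\<^esub> f \<in> carrier (Cinf M)"
  using assms
  by (auto simp: Cinf_def oriented_smooth_manifold_def smooth_atlas_def is_chart_def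
      intro!: smooth_on_Euclidean_cmult)

text \<open>Replaces a real scalar by the constant function with that value, so that relators over
  the reals become relators over \<open>Cinf M\<close>. Off the manifold, where the unit is
  \<open>0\<close>, both sides vanish because \<open>f\<close> does.\<close>

lemma Cinf_smult_one_mult:
  "f \<in> carrier (Cinf M) \<Longrightarrow> (r \<odot>\<^bsub>Cinf M\<^esub> \<one>\<^bsub>Cinf M\<^esub>) \<otimes>\<^bsub>Cinf M\<^esub> f = r \<odot>\<^bsub>Cinf M\<^esub> f"
  by (auto simp: Cinf_def indicator_def fun_eq_iff)

lemma distributions_add_closed:
  "v \<in> carrier (distributions M) \<Longrightarrow> w \<in> carrier (distributions M) \<Longrightarrow>
   v \<oplus>\<^bsub>distributions M\<^esub> w \<in> carrier (distributions M)"
  by (auto simp: distributions_def algebra_simps intro!: continuous_map_add)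

lemma distributions_smult_closed:
  "v \<in> carrier (distributions M) \<Longrightarrow> r \<odot>\<^bsub>distributions M\<^esub> v \<in> carrier (distributions M)"
  by (auto simp: distributions_def algebra_simps intro!: continuous_map_real_mult_left)

section \<open>Passage from tensors over the reals to tensors over the smooth functions\<close>

theorem proposition4p1:
  fixes M :: "'a oriented_manifold"
    and A :: "(real, 'b) module"
    and act :: "('a \<Rightarrow> real) \<Rightarrow> 'b \<Rightarrow> 'b"
    and \<iota> :: "('a form \<Rightarrow> real) \<Rightarrow> 'b"
  assumes "oriented_smooth_manifold M"
    and "Module.algebra class_ring A"
    and "Module.module (Cinf M) (with_smult A act)"
    and "\<And>r a. a \<in> carrier A \<Longrightarrow> act (r \<odot>\<^bsub>Cinf M\<^esub> \<one>\<^bsub>Cinf M\<^esub>) a = r \<odot>\<^bsub>A\<^esub> a"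
    and "\<iota> \<in> LinearCombinations.module_hom class_ring (distributions M) A"
    and "inj_on \<iota> (carrier (distributions M))"
    and "\<iota> (function_distr M \<one>\<^bsub>Cinf M\<^esub>) = \<one>\<^bsub>A\<^esub>"
  shows
    "(\<forall>v\<in>carrier (distributions M). \<forall>f\<in>carrier (Cinf M). \<forall>g\<in>carrier (Cinf M).
        tensor_map (Cinf M) (with_smult A act) (Cinf_self_module M) \<iota> id
          (tensor class_ring (distributions M) (Cinf M) (distr_mult M f v) g)
      = tensor_map (Cinf M) (with_smult A act) (Cinf_self_module M) \<iota> id
          (tensor class_ring (distributions M) (Cinf M) v (f \<otimes>\<^bsub>Cinf M\<^esub> g)))
     \<longleftrightarrow> \<iota> \<in> LinearCombinations.module_hom (Cinf M) (distributions_Cinf M) (with_smult A act)"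
proof -
  let ?C = "Cinf M" and ?D = "distributions M" and ?N = "with_smult A act"
  let ?S = "Cinf_self_module M"
  interpret N: Module.module ?C ?N by fact
  have N: "carrier ?N = carrier A" "add ?N = add A" "smult ?N = act"
    and S: "carrier ?S = carrier ?C" "add ?S = add ?C" "smult ?S = mult ?C"
    and D: "carrier (distributions_Cinf M) = carrier ?D" "add (distributions_Cinf M) = add ?D"
      "smult (distributions_Cinf M) = distr_mult M"
    by (simp_all add: with_smult_def)
  have \<iota>_closed: "\<iota> v \<in> carrier A" if "v \<in> carrier ?D" for v
    using assms(5) that by (auto simp: LinearCombinations.module_hom_def)
  have \<iota>_add: "\<iota> (v \<oplus>\<^bsub>?D\<^esub> w) = \<iota> v \<oplus>\<^bsub>A\<^esub> \<iota> w" if "v \<in> carrier ?D" "w \<in> carrier ?D" for v w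
    using assms(5) that by (auto simp: LinearCombinations.module_hom_def)
  \<comment> \<open>Real linearity of \<iota>, rewritten with the hypothesis that constant functions
    act on \<open>A\<close> as real scalars.\<close>
  have \<iota>_smult: "\<iota> (r \<odot>\<^bsub>?D\<^esub> v) = act (r \<odot>\<^bsub>?C\<^esub> \<one>\<^bsub>?C\<^esub>) (\<iota> v)" if "v \<in> carrier ?D" for r v
    using assms(5) that assms(4)[OF \<iota>_closed[OF that]]
    by (auto simp: LinearCombinations.module_hom_def)
  have const: "r \<odot>\<^bsub>?C\<^esub> \<one>\<^bsub>?C\<^esub> \<in> carrier ?C" for r
    by (intro Cinf_smult_closed assms(1)) simp
  have rel0: "tensor_relators class_ring ?D ?C
      \<subseteq> carrier (free_Abelian_group (carrier ?D \<times> carrier ?C))"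
    by (rule tensor_relators_subset)
      (auto intro: distributions_add_closed distributions_smult_closed
        Cinf_smult_closed[OF assms(1)])
  have rel: "tensor_relators ?C ?N ?S \<subseteq> carrier (free_Abelian_group (carrier ?N \<times> carrier ?S))"
    by (rule tensor_relators_subset) (auto simp: S)
  \<comment> \<open>Each real relator is sent to a single relator over \<open>Cinf M\<close>; for
    the scalar relators, the constant function \<open>r\<close> serves as the new scalar.\<close>
  have resp: "frag_extend (\<lambda>(m, n). frag_of (\<iota> m, id n)) ` tensor_relators class_ring ?D ?C
      \<subseteq> tensor_relators ?C ?N ?S"
  proof (rule image_subsetI)
    fix z assume "z \<in> tensor_relators class_ring ?D ?C"
    then show "frag_extend (\<lambda>(m, n). frag_of (\<iota> m, id n)) z \<in> tensor_relators ?C ?N ?S"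
      unfolding tensor_relators_def[of class_ring]
    proof (elim UnE CollectE exE conjE)
      fix m m' n
      assume z: "z = frag_of (m \<oplus>\<^bsub>?D\<^esub> m', n) - frag_of (m, n) - frag_of (m', n)"
        and mn: "m \<in> carrier ?D" "m' \<in> carrier ?D" "n \<in> carrier ?C"
      have "frag_extend (\<lambda>(m, n). frag_of (\<iota> m, id n)) z =
          frag_of (\<iota> m \<oplus>\<^bsub>A\<^esub> \<iota> m', n) - frag_of (\<iota> m, n) - frag_of (\<iota> m', n)"
        by (simp add: z frag_extend_diff \<iota>_add mn)
      then show ?thesis
        unfolding tensor_relators_def N S using mn(3) \<iota>_closed[OF mn(1)] \<iota>_closed[OF mn(2)]
        by blast
    next
      fix m n n'
      assume z: "z = frag_of (m, n \<oplus>\<^bsub>?C\<^esub> n') - frag_of (m, n) - frag_of (m, n')"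
        and mn: "m \<in> carrier ?D" "n \<in> carrier ?C" "n' \<in> carrier ?C"
      have "frag_extend (\<lambda>(m, n). frag_of (\<iota> m, id n)) z =
          frag_of (\<iota> m, n \<oplus>\<^bsub>?C\<^esub> n') - frag_of (\<iota> m, n) - frag_of (\<iota> m, n')"
        by (simp add: z frag_extend_diff)
      then show ?thesis
        unfolding tensor_relators_def N S using mn(2,3) \<iota>_closed[OF mn(1)] by blast
    next
      fix r m n
      assume z: "z = frag_of (r \<odot>\<^bsub>?D\<^esub> m, n) - frag_of (m, r \<odot>\<^bsub>?C\<^esub> n)"
        and mn: "m \<in> carrier ?D" "n \<in> carrier ?C"
      have "frag_extend (\<lambda>(m, n). frag_of (\<iota> m, id n)) z =
          frag_of (act (r \<odot>\<^bsub>?C\<^esub> \<one>\<^bsub>?C\<^esub>) (\<iota> m), n)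
            - frag_of (\<iota> m, (r \<odot>\<^bsub>?C\<^esub> \<one>\<^bsub>?C\<^esub>) \<otimes>\<^bsub>?C\<^esub> n)"
        by (simp add: z frag_extend_diff \<iota>_smult Cinf_smult_one_mult mn)
      then show ?thesis
        unfolding tensor_relators_def N S using const mn(2) \<iota>_closed[OF mn(1)] by blast
    qed
  qed
  also have "tensor_relators ?C ?N ?S \<subseteq> tensor_kernel ?C ?N ?S"
    unfolding tensor_kernel_def by (auto intro: generate.incl)
  \<comment> \<open>This holds for all \<open>v\<close> and \<open>g\<close>, in particular with
    \<open>distr_mult M f v\<close> in place of \<open>v\<close>, whose continuity has not been
    established.\<close>
  finally have map: "tensor_map ?C ?N ?S \<iota> id (tensor class_ring ?D ?C v g) =
      tensor ?C ?N ?S (\<iota> v) g" for v g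
    using tensor_map_tensor_any[OF rel0 rel, of \<iota> id v g] by simp
  show ?thesis
    unfolding map
  proof (intro iffI ballI)
    assume balanced: "\<forall>v\<in>carrier ?D. \<forall>f\<in>carrier ?C. \<forall>g\<in>carrier ?C.
      tensor ?C ?N ?S (\<iota> (distr_mult M f v)) g = tensor ?C ?N ?S (\<iota> v) (f \<otimes>\<^bsub>?C\<^esub> g)"
    have "\<iota> (distr_mult M f v) = act f (\<iota> v)" if v: "v \<in> carrier ?D" and f: "f \<in> carrier ?C" for v f
    proof -
      \<comment> \<open>Balancedness is used at \<open>g = 1\<close> only.\<close>
      have eq: "tensor ?C ?N ?S (\<iota> (distr_mult M f v)) \<one>\<^bsub>?C\<^esub> = tensor ?C ?N ?S (\<iota> v) f"
        using balanced v f by (metis N.R.one_closed N.R.r_one)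
      \<comment> \<open>The right side of \<open>eq\<close> is a tensor of elements of the carriers,
        which forces the left factor into \<open>A\<close> as well.\<close>
      have "\<iota> (distr_mult M f v) \<in> carrier ?N"
        using tensor_eq_imp_carrier[OF rel eq] f \<iota>_closed[OF v] by (simp add: N S)
      \<comment> \<open>Multiplying out both sides of \<open>eq\<close> gives \<open>1\<close>
        acting on the left factor and \<open>f\<close> acting on \<iota>(v).\<close>
      then show ?thesis
        using tensor_self_module_eq_imp_smult_eq[OF assms(3) _ _ _ f eq] \<iota>_closed[OF v]
          N.smult_one by (simp add: N)
    qed
    then show "\<iota> \<in> LinearCombinations.module_hom ?C (distributions_Cinf M) ?N"
      using \<iota>_closed \<iota>_add by (auto simp: LinearCombinations.module_hom_def N D)
  next
    fix v f g
    assume \<iota>: "\<iota> \<in> LinearCombinations.module_hom ?C (distributions_Cinf M) ?N"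
      and v: "v \<in> carrier ?D" and fg: "f \<in> carrier ?C" "g \<in> carrier ?C"
    have "\<iota> (distr_mult M f v) = act f (\<iota> v)"
      using \<iota> v fg(1) by (auto simp: LinearCombinations.module_hom_def N D)
    \<comment> \<open>Linearity rewrites the first factor as \<open>act f\<close> applied to
      \<iota>(v), and the scalar relator moves \<open>f\<close> over to \<open>g\<close>.\<close>
    then show "tensor ?C ?N ?S (\<iota> (distr_mult M f v)) g = tensor ?C ?N ?S (\<iota> v) (f \<otimes>\<^bsub>?C\<^esub> g)"
      using tensor_smult[OF rel fg(1), of "\<iota> v" g] \<iota>_closed[OF v] fg(2) by (simp add: N S)
  qed
qed

end
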